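(* Let $p$ be a prime and let $n \geq 4$ be an integer. If $p$ is odd, then $f(n) \leq 3$. If $p = 2$, then $f(n) \leq 4$.
   Context: $\mathbb{Z}_p$ is the ring of $p$-adic integers and $M_n(\mathbb{Z}_p)$ is the ring of $n \times n$ matrices over $\mathbb{Z}_p$. A form $\sum_{i=1}^m a_i X_i^2$ with $a_i \in \mathbb{Z}_p$ is universal over $M_n(\mathbb{Z}_p)$ if for every $A \in M_n(\mathbb{Z}_p)$ there exist $X_1, \ldots, X_m \in M_n(\mathbb{Z}_p)$ with $A = \sum_{i=1}^m a_i X_i^2$. For a fixed prime $p$ and an integer $n \geq 3$, $f(n)$ is the smallest integer $m \geq 3$ such that for all $p$-adic integers $a_1, a_2, \ldots, a_m$ with at least three of them (counted by index) units, the form $\sum_{i=1}^m a_i X_i^2$ is universal over $M_n(\mathbb{Z}_p)$. *)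

theory Defs
  imports
    "Jordan_Normal_Form.Matrix"
    "Berlekamp_Zassenhaus.Finite_Field"
    "HOL-Library.Extended_Nat"
begin

text \<open>
  The ring of \<open>p\<close>-adic integers as the inverse limit of the rings \<open>\<int>/p\<^sup>k\<int>\<close>, for the prime
  \<open>p = CARD('p)\<close>. A residue class modulo \<open>p\<^sup>k\<close> is represented by its element in \<open>{0..<p\<^sup>k}\<close>;
  the compatibility condition below already forces every \<open>x k\<close> into that range.
\<close>

typedef ('p::prime_card) padic_int =
  "{x :: nat \<Rightarrow> int. \<forall>k. x (Suc k) mod int CARD('p) ^ k = x k}"
  morphisms padic_residue Abs_padic_int
  by (intro exI[of _ "\<lambda>_. 0"]) simp

setup_lifting type_definition_padic_int

lemma padic_residue_Suc_mod [simp]: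
  "padic_residue (x :: 'p::prime_card padic_int) (Suc k) mod int CARD('p) ^ k = padic_residue x k"
  using padic_residue[of x] by simp

lemma padic_residue_mod [simp]:
  "padic_residue (x :: 'p::prime_card padic_int) k mod int CARD('p) ^ k = padic_residue x k"
  by (metis mod_mod_trivial padic_residue_Suc_mod)

lemma mod_power_Suc_mod: "(a :: int) mod q ^ Suc k mod q ^ k = a mod q ^ k"
  by (rule mod_mod_cancel) simp

instantiation padic_int :: (prime_card) comm_ring_1
begin

lift_definition zero_padic_int :: "'a padic_int" is "\<lambda>k. 0"
  by simp

lift_definition one_padic_int :: "'a padic_int" is "\<lambda>k. 1 mod int CARD('a) ^ k"
  by (simp only: mod_power_Suc_mod simp_thms)

lift_definition plus_padic_int :: "'a padic_int \<Rightarrow> 'a padic_int \<Rightarrow> 'a padic_int"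
  is "\<lambda>x y k. (x k + y k) mod int CARD('a) ^ k"
  by (metis mod_power_Suc_mod mod_add_eq)

lift_definition minus_padic_int :: "'a padic_int \<Rightarrow> 'a padic_int \<Rightarrow> 'a padic_int"
  is "\<lambda>x y k. (x k - y k) mod int CARD('a) ^ k"
  by (metis mod_power_Suc_mod mod_diff_eq)

lift_definition uminus_padic_int :: "'a padic_int \<Rightarrow> 'a padic_int"
  is "\<lambda>x k. (- x k) mod int CARD('a) ^ k"
  by (metis mod_power_Suc_mod mod_minus_eq)

lift_definition times_padic_int :: "'a padic_int \<Rightarrow> 'a padic_int \<Rightarrow> 'a padic_int"
  is "\<lambda>x y k. (x k * y k) mod int CARD('a) ^ k"
  by (metis mod_power_Suc_mod mod_mult_eq)

instance
proof
  fix a b c :: "'a padic_int"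
  show "a + b + c = a + (b + c)"
    by transfer (simp add: mod_simps algebra_simps)
  show "a + b = b + a"
    by transfer (simp add: algebra_simps)
  show "0 + a = a"
    by (rule padic_residue_inject[THEN iffD1])
      (simp add: plus_padic_int.rep_eq zero_padic_int.rep_eq)
  show "- a + a = 0"
    by transfer (simp add: mod_simps)
  show "a - b = a + - b"
    by transfer (simp add: mod_simps)
  show "a * b * c = a * (b * c)"
    by transfer (simp add: mod_simps algebra_simps)
  show "a * b = b * a"
    by transfer (simp add: algebra_simps)
  show "1 * a = a"
    by (rule padic_residue_inject[THEN iffD1])
      (simp add: times_padic_int.rep_eq one_padic_int.rep_eq mod_simps)
  show "(a + b) * c = a * c + b * c"
    by transfer (simp add: mod_simps algebra_simps)
  have "padic_residue (0 :: 'a padic_int) 1 \<noteq> padic_residue 1 1"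
    using nontriv[where 'a = 'a] by (simp add: zero_padic_int.rep_eq one_padic_int.rep_eq)
  then show "(0 :: 'a padic_int) \<noteq> 1"
    by auto
qed

end

definition universal_form :: "nat \<Rightarrow> nat \<Rightarrow> (nat \<Rightarrow> 'a::comm_ring_1) \<Rightarrow> bool" where
  "universal_form n m a \<longleftrightarrow>
    (\<forall>A \<in> carrier_mat n n. \<exists>X. (\<forall>i<m. X i \<in> carrier_mat n n) \<and>
      A = (\<Oplus>\<^bsub>ring_mat TYPE('a) n ()\<^esub> i \<in> {..<m}. a i \<cdot>\<^sub>m (X i ^\<^sub>m 2)))"

text \<open>
  The function \<open>f(n)\<close> for the prime \<open>p = CARD('p)\<close>. The minimum is taken in \<open>enat\<close>, so it is
  \<open>\<infinity>\<close> if no \<open>m\<close> qualifies; a finite upper bound therefore includes the existence of such an \<open>m\<close>.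
  The coefficients are \<open>a 0, \<dots>, a (m - 1)\<close>, and \<open>a i dvd 1\<close> says that \<open>a i\<close> is a unit.
\<close>

definition min_universal :: "'p::prime_card itself \<Rightarrow> nat \<Rightarrow> enat" where
  "min_universal TYPE('p) n =
    Inf (enat ` {m. m \<ge> 3 \<and>
      (\<forall>a :: nat \<Rightarrow> 'p padic_int. card {i. i < m \<and> a i dvd 1} \<ge> 3 \<longrightarrow> universal_form n m a)})"

end

theory Submission
  imports Defs
begin

text \<open>
  Three unit coefficients \<open>a\<close>, \<open>b\<close>, \<open>c\<close> suffice over every commutative ring in which each element is a
  square modulo \<open>2\<close>, in particular over the \<open>p\<close>-adic integers for every prime \<open>p\<close>, even or odd. Colour
  the index \<open>i\<close> by \<open>i mod 3\<close> and group indices by colour. A block triangular \<open>X\<close> with diagonal blocks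
  \<open>C\<close>, \<open>0\<close>, \<open>1\<close>, where \<open>C\<close> and \<open>1 + C\<close> are invertible, can be chosen so that \<open>X\<^sup>2\<close> has any prescribed
  blocks below the diagonal: the Sylvester maps \<open>V \<mapsto> X\<^sub>i V + V X\<^sub>j\<close> are bijective. Hence \<open>a X\<^sup>2\<close> and
  \<open>b Y\<^sup>2\<close>, with \<open>Y\<close> the transpose of such a matrix, supply all entries between distinct colours, and
  it remains to find \<open>Z\<close> such that \<open>Z\<^sup>2\<close> has prescribed entries between indices of equal colour. Let
  \<open>J\<close> be the shift \<open>e\<^sub>k \<mapsto> e\<^sub>k\<^sub>+\<^sub>1\<close> and \<open>Z = J + K + D\<close> with \<open>K\<close> lowering the colour by one and \<open>D\<close>
  preserving it. On equal colours \<open>Z\<^sup>2\<close> is \<open>JK + KJ + D\<^sup>2\<close>, and \<open>JK + KJ = M\<close> is solvable as soon as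
  the alternating sums of \<open>M\<close> along the main and upper diagonals vanish; \<open>D\<close> is chosen to correct
  these sums.
\<close>

section \<open>Blocks \<open>C\<close> for which \<open>C\<close> and \<open>1 + C\<close> are
  invertible\<close>

text \<open>
  \<open>D\<close> and \<open>F\<close> are left inverses of \<open>C\<close> and \<open>1 + C\<close>. The blocks of size \<open>2\<close> and \<open>3\<close> are the companion
  matrices of \<open>x\<^sup>2 + x + 1\<close> and \<open>x\<^sup>3 + x\<^sup>2 + 1\<close>; modulo \<open>2\<close> no block of size \<open>1\<close> works.
\<close>
lemma coprime_block_lessThan:
  assumes "r \<ge> 2"
  shows "\<exists>D C F :: nat \<Rightarrow> nat \<Rightarrow> 'a::comm_ring_1. \<forall>i<r. \<forall>j<r.
    (\<Sum>k<r. D i k * C k j) = of_bool (i = j) \<and>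
    (\<Sum>k<r. F i k * C k j) + F i j = of_bool (i = j)"
  using assms
proof (induction r rule: less_induct)
  case (less r)
  consider "r = 2" | "r = 3" | "r \<ge> 4"
    using less.prems by linarith
  then show ?case
  proof cases
    case 1
    let ?C = "\<lambda>i j. [[0, -1], [1, -1]] ! i ! j :: 'a"
    let ?D = "\<lambda>i j. [[-1, 1], [-1, 0]] ! i ! j :: 'a"
    let ?F = "\<lambda>i j. [[0, 1], [-1, 1]] ! i ! j :: 'a"
    show ?thesis
      by (rule exI[of _ ?D], rule exI[of _ ?C], rule exI[of _ ?F])
        (simp add: 1 numeral_2_eq_2 All_less_Suc2)
  next
    case 2
    let ?C = "\<lambda>i j. [[0, 0, -1], [1, 0, 0], [0, 1, -1]] ! i ! j :: 'a"
    let ?D = "\<lambda>i j. [[0, 1, 0], [-1, 0, 1], [-1, 0, 0]] ! i ! j :: 'a"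
    let ?F = "\<lambda>i j. [[0, 1, -1], [0, 0, 1], [-1, 1, -1]] ! i ! j :: 'a"
    show ?thesis
      by (rule exI[of _ ?D], rule exI[of _ ?C], rule exI[of _ ?F])
        (simp add: 2 numeral_3_eq_3 All_less_Suc2)
  next
    case 3
    define q where "q = r - 2"
    with 3 have r: "r = Suc (Suc q)" and "q < r" "q \<ge> 2"
      by auto
    then obtain D C F :: "nat \<Rightarrow> nat \<Rightarrow> 'a" where CDF: "\<forall>i<q. \<forall>j<q.
        (\<Sum>k<q. D i k * C k j) = of_bool (i = j) \<and>
        (\<Sum>k<q. F i k * C k j) + F i j = of_bool (i = j)"
      using less.IH by blast
    \<comment> \<open>\<open>?ext\<close> is the direct sum of a block of size 2 and one of size
      \<open>q\<close>, so sizes 2 and 3 generate all larger ones.\<close>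
    let ?ext = "\<lambda>B M i j. if i < 2 \<and> j < 2 then B ! i ! j
      else if 2 \<le> i \<and> 2 \<le> j then M (i - 2) (j - 2) else (0 :: 'a)"
    let ?C = "?ext [[0, -1], [1, -1]] C"
    let ?D = "?ext [[-1, 1], [-1, 0]] D"
    let ?F = "?ext [[0, 1], [-1, 1]] F"
    show ?thesis
      by (rule exI[of _ ?D], rule exI[of _ ?C], rule exI[of _ ?F])
        (simp add: r All_less_Suc2 sum.lessThan_Suc_shift CDF del: sum.lessThan_Suc)
  qed
qed

lemma coprime_block:
  fixes S :: "'b set"
  assumes "card S \<ge> 2"
  obtains D C F :: "'b \<Rightarrow> 'b \<Rightarrow> 'a::comm_ring_1"
  where "\<And>i j. i \<in> S \<Longrightarrow> j \<in> S \<Longrightarrow> (\<Sum>k\<in>S. D i k * C k j) = of_bool (i = j)"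
    and "\<And>i j. i \<in> S \<Longrightarrow> j \<in> S \<Longrightarrow> (\<Sum>k\<in>S. F i k * C k j) + F i j = of_bool (i = j)"
proof -
  have "finite S"
    using assms by (metis card.infinite not_numeral_le_zero)
  then obtain g where g: "bij_betw g S {..<card S}"
    using ex_bij_betw_finite_nat[of S] by (auto simp: atLeast0LessThan)
  obtain D C F :: "nat \<Rightarrow> nat \<Rightarrow> 'a" where CDF: "\<And>i j. i < card S \<Longrightarrow> j < card S \<Longrightarrow>
        (\<Sum>k<card S. D i k * C k j) = of_bool (i = j) \<and>
        (\<Sum>k<card S. F i k * C k j) + F i j = of_bool (i = j)"
    using coprime_block_lessThan[OF assms] by blast
  have g_less: "g i < card S" if "i \<in> S" for i
    using g that by (auto simp: bij_betw_def)
  have g_eq: "g i = g j \<longleftrightarrow> i = j" if "i \<in> S" "j \<in> S" for i j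
    using g that by (auto simp: bij_betw_def inj_on_def)
  show thesis
  proof (rule that[of "\<lambda>i j. D (g i) (g j)" "\<lambda>i j. C (g i) (g j)" "\<lambda>i j. F (g i) (g j)"])
    fix i j assume ij: "i \<in> S" "j \<in> S"
    show "(\<Sum>k\<in>S. D (g i) (g k) * C (g k) (g j)) = of_bool (i = j)"
      using CDF[of "g i" "g j"] ij g_less g_eq
        sum.reindex_bij_betw[OF g, of "\<lambda>k. D (g i) k * C k (g j)"] by simp
    show "(\<Sum>k\<in>S. F (g i) (g k) * C (g k) (g j)) + F (g i) (g j) = of_bool (i = j)"
      using CDF[of "g i" "g j"] ij g_less g_eq
        sum.reindex_bij_betw[OF g, of "\<lambda>k. F (g i) k * C k (g j)"] by simp
  qed
qed

section \<open>Squares with prescribed blocks below the diagonal\<close>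

lemma sum_mod_3:
  fixes f :: "nat \<Rightarrow> 'a::comm_monoid_add"
  shows "(\<Sum>k<n. f k) = (\<Sum>k | k < n \<and> k mod 3 = 0. f k) +
    (\<Sum>k | k < n \<and> k mod 3 = 1. f k) + (\<Sum>k | k < n \<and> k mod 3 = 2. f k)"
proof -
  let ?S = "\<lambda>c. {k. k < n \<and> k mod 3 = c}"
  have "{..<n} = ?S 0 \<union> ?S 1 \<union> ?S 2"
    by auto
  then have "(\<Sum>k<n. f k) = sum f (?S 0 \<union> ?S 1 \<union> ?S 2)"
    by (rule arg_cong)
  also have "\<dots> = sum f (?S 0 \<union> ?S 1) + sum f (?S 2)"
    by (rule sum.union_disjoint) auto
  also have "sum f (?S 0 \<union> ?S 1) = sum f (?S 0) + sum f (?S 1)"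
    by (rule sum.union_disjoint) auto
  finally show ?thesis .
qed

lemma sum_mult_assoc:
  fixes f :: "'b \<Rightarrow> 'a::semiring_0"
  shows "(\<Sum>k\<in>S. (\<Sum>l\<in>T. f l * g l k) * h k) = (\<Sum>l\<in>T. f l * (\<Sum>k\<in>S. g l k * h k))"
  by (simp add: sum_distrib_left sum_distrib_right mult.assoc) (rule sum.swap)

text \<open>The diagonal blocks of \<open>X\<close> can be fixed before \<open>W\<close> is known,
  and they alone determine the diagonal blocks \<open>\<Delta>\<close> of the square. So
  \<open>\<Delta>\<close> can be compensated first and \<open>W\<close> chosen afterwards.\<close>

lemma block_lower_square:
  assumes "n \<ge> 4"
  obtains \<Delta> :: "nat \<Rightarrow> nat \<Rightarrow> 'a::comm_ring_1"
  where "\<And>W. \<exists>X. \<forall>i<n. \<forall>j<n. (\<Sum>k<n. X i k * X k j) =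
    (if i mod 3 > j mod 3 then W i j else if i mod 3 = j mod 3 then \<Delta> i j else 0)"
proof -
  let ?S = "\<lambda>c. {k. k < n \<and> k mod 3 = c}"
  \<comment> \<open>Since \<open>n \<ge> 4\<close>, the indices 0 and 3 give colour 0 the two
    elements that \<open>coprime_block\<close> requires.\<close>
  have "card {0, 3 :: nat} \<le> card (?S 0)"
    using assms by (intro card_mono) auto
  then have "card (?S 0) \<ge> 2"
    by simp
  then obtain D C F :: "nat \<Rightarrow> nat \<Rightarrow> 'a"
    where DC: "\<And>i j. i \<in> ?S 0 \<Longrightarrow> j \<in> ?S 0 \<Longrightarrow> (\<Sum>k\<in>?S 0. D i k * C k j) = of_bool (i = j)"
    and FC: "\<And>i j. i \<in> ?S 0 \<Longrightarrow> j \<in> ?S 0 \<Longrightarrow>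
        (\<Sum>k\<in>?S 0. F i k * C k j) + F i j = of_bool (i = j)"
    by (rule coprime_block) blast
  define E where "E i j = (if i mod 3 = 0 then C i j else of_bool (i mod 3 = 2 \<and> i = j))" for i j
  define \<Delta> where "\<Delta> i j = (\<Sum>k\<in>?S (i mod 3). E i k * E k j)" for i j
  show thesis
  proof (rule that[of \<Delta>])
    fix W :: "nat \<Rightarrow> nat \<Rightarrow> 'a"
    \<comment> \<open>Writing W_rs for the block with row colour r and column colour s, the square
      requires U C = W_10 and V (C + 1) = W_20 - W_21 U. Multiplying the right-hand sides by
      \<open>D\<close> and \<open>F\<close> from the right solves both.\<close>
    define U where "U i j = (\<Sum>k\<in>?S 0. W i k * D k j)" for i j
    define V where "V i j = (\<Sum>l\<in>?S 0. (W i l - (\<Sum>k\<in>?S 1. W i k * U k l)) * F l j)" for i j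
    define X where "X i j =
      (if i mod 3 = j mod 3 then E i j
       else if i mod 3 = 1 \<and> j mod 3 = 0 then U i j
       else if i mod 3 = 2 \<and> j mod 3 = 1 then W i j
       else if i mod 3 = 2 \<and> j mod 3 = 0 then V i j else 0)" for i j
    have UC: "(\<Sum>k\<in>?S 0. U i k * C k j) = W i j" if "j \<in> ?S 0" for i j
    proof -
      have "(\<Sum>k\<in>?S 0. U i k * C k j) = (\<Sum>l\<in>?S 0. W i l * (\<Sum>k\<in>?S 0. D l k * C k j))"
        unfolding U_def by (rule sum_mult_assoc)
      also have "\<dots> = (\<Sum>l\<in>?S 0. W i l * of_bool (l = j))"
        using that by (intro sum.cong refl) (simp only: DC)
      finally show ?thesis
        using that by simp
    qed
    have VC: "(\<Sum>k\<in>?S 0. V i k * C k j) + V i j = W i j - (\<Sum>k\<in>?S 1. W i k * U k j)"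
      if "j \<in> ?S 0" for i j
    proof -
      let ?w = "\<lambda>l. W i l - (\<Sum>k\<in>?S 1. W i k * U k l)"
      have "(\<Sum>k\<in>?S 0. V i k * C k j) + V i j =
          (\<Sum>l\<in>?S 0. ?w l * (\<Sum>k\<in>?S 0. F l k * C k j)) + V i j"
        unfolding V_def by (subst sum_mult_assoc) (rule refl)
      also have "\<dots> = (\<Sum>l\<in>?S 0. ?w l * ((\<Sum>k\<in>?S 0. F l k * C k j) + F l j))"
        unfolding V_def by (simp only: distrib_left sum.distrib)
      also have "\<dots> = (\<Sum>l\<in>?S 0. ?w l * of_bool (l = j))"
        using that by (intro sum.cong refl) (simp only: FC)
      finally show ?thesis
        using that by simp
    qed
    have "(\<Sum>k<n. X i k * X k j) =
        (if i mod 3 > j mod 3 then W i j else if i mod 3 = j mod 3 then \<Delta> i j else 0)"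
      if ij: "i < n" "j < n" for i j
    proof -
      have split: "(\<Sum>k<n. X i k * X k j) = (\<Sum>k\<in>?S 0. X i k * X k j) +
          (\<Sum>k\<in>?S 1. X i k * X k j) + (\<Sum>k\<in>?S 2. X i k * X k j)"
        by (rule sum_mod_3)
      have "i mod 3 < 3" "j mod 3 < 3" by simp_all
      then consider
          "i mod 3 < j mod 3" | "i mod 3 = j mod 3"
        | "i mod 3 = 1" "j mod 3 = 0" | "i mod 3 = 2" "j mod 3 = 1" | "i mod 3 = 2" "j mod 3 = 0"
        by linarith
      then show ?thesis
      proof cases
        case 1
        then have "X i k * X k j = 0" for k
          by (auto simp: X_def)
        then show ?thesis using 1 by simp
      next
        case 2
        then have "(\<Sum>k<n. X i k * X k j) = \<Delta> i j"
          unfolding \<Delta>_def by (intro sum.mono_neutral_cong_right) (auto simp: X_def)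
        then show ?thesis using 2 by simp
      next
        case 3
        have "(\<Sum>k\<in>?S 0. X i k * X k j) = (\<Sum>k\<in>?S 0. U i k * C k j)"
          using 3 by (intro sum.cong refl) (auto simp: X_def E_def)
        moreover have "(\<Sum>k\<in>?S 1. X i k * X k j) = 0"
          using 3 by (intro sum.neutral) (auto simp: X_def E_def)
        moreover have "(\<Sum>k\<in>?S 2. X i k * X k j) = 0"
          using 3 by (intro sum.neutral) (auto simp: X_def)
        ultimately show ?thesis
          using 3 ij split UC[of j i] by simp
      next
        case 4
        have "(\<Sum>k\<in>?S 0. X i k * X k j) = 0"
          using 4 by (intro sum.neutral) (auto simp: X_def)
        moreover have "(\<Sum>k\<in>?S 1. X i k * X k j) = 0"
          using 4 by (intro sum.neutral) (auto simp: X_def E_def)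
        moreover have "(\<Sum>k\<in>?S 2. X i k * X k j) = (\<Sum>k\<in>?S 2. if k = i then W k j else 0)"
          using 4 by (intro sum.cong refl) (auto simp: X_def E_def)
        ultimately show ?thesis
          using 4 ij split by simp
      next
        case 5
        have "(\<Sum>k\<in>?S 0. X i k * X k j) = (\<Sum>k\<in>?S 0. V i k * C k j)"
          using 5 by (intro sum.cong refl) (auto simp: X_def E_def)
        moreover have "(\<Sum>k\<in>?S 1. X i k * X k j) = (\<Sum>k\<in>?S 1. W i k * U k j)"
          using 5 by (intro sum.cong refl) (auto simp: X_def)
        moreover have "(\<Sum>k\<in>?S 2. X i k * X k j) = (\<Sum>k\<in>?S 2. if k = i then V k j else 0)"
          using 5 by (intro sum.cong refl) (auto simp: X_def E_def)
        ultimately show ?thesis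
          using 5 ij split VC[of j i] by (simp add: algebra_simps)
      qed
    qed
    then show "\<exists>X. \<forall>i<n. \<forall>j<n. (\<Sum>k<n. X i k * X k j) =
        (if i mod 3 > j mod 3 then W i j else if i mod 3 = j mod 3 then \<Delta> i j else 0)"
      by blast
  qed
qed

section \<open>Squares with prescribed entries between equal colours\<close>

text \<open>\<open>d\<close> becomes the diagonal of \<open>D\<close>: the first property keeps the
  first row of \<open>D\<close> unchanged under squaring off the diagonal, the second prescribes the
  alternating trace. Differences of two squares supply the part linear in 2, one more square the
  rest.\<close>

lemma alternating_sum_squares:
  fixes h :: "'a::comm_ring_1"
  assumes "n \<ge> 4" and sq: "\<And>x :: 'a. \<exists>y z. x = y * y + 2 * z"
  obtains d :: "nat \<Rightarrow> 'a"
  where "\<And>j. 0 < j \<Longrightarrow> j < n \<Longrightarrow> 3 dvd j \<Longrightarrow> d 0 + d j = 1"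
    and "(\<Sum>s<n. (-1) ^ s * (d s * d s)) = h"
proof (cases "n = 4")
  case True
  obtain t s where ts: "h + 1 = t * t + 2 * s"
    using sq by blast
  \<comment> \<open>Position 3 is forced to carry \<open>1 - d 0\<close>, and s^2 - (1 - s)^2 = 2s -
    1; position 2 adds t^2.\<close>
  define d where "d i = (if i = 0 then s else if i = 2 then t else if i = 3 then 1 - s else 0)"
    for i :: nat
  have h: "h = t * t + 2 * s - 1"
    using ts by (simp add: algebra_simps)
  show thesis
  proof (rule that[of d])
    show "d 0 + d j = 1" if "0 < j" "j < n" "3 dvd j" for j
    proof -
      have "j = 3"
        using that True by presburger
      then show ?thesis
        by (simp add: d_def)
    qed
    show "(\<Sum>s<n. (-1) ^ s * (d s * d s)) = h"
      by (simp add: True d_def h numeral_eq_Suc algebra_simps)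
  qed
next
  case False
  obtain v z where vz: "h - 2 = v * v + 2 * z"
    using sq by blast
  \<comment> \<open>Now position 4 exists and is free to carry \<open>v\<close>; positions 0, 1, 2
    give 1 - z^2 + (z + 1)^2 = 2z + 2.\<close>
  define d where "d i = (if i = 0 then 1 else if i = 1 then z else if i = 2 then z + 1
    else if i = 4 then v else 0)" for i :: nat
  have h: "h = v * v + 2 * z + 2"
    using vz by (simp add: algebra_simps)
  show thesis
  proof (rule that[of d])
    show "d 0 + d j = 1" if "0 < j" "j < n" "3 dvd j" for j
    proof -
      have "j \<noteq> 1" "j \<noteq> 2" "j \<noteq> 4"
        using that by presburger+
      then show ?thesis
        using that by (simp add: d_def)
    qed
    have "(\<Sum>s<n. (-1) ^ s * (d s * d s)) = (\<Sum>s\<in>{0, 1, 2, 4}. (-1) ^ s * (d s * d s))"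
      using assms(1) False by (intro sum.mono_neutral_right) (auto simp: d_def)
    then show "(\<Sum>s<n. (-1) ^ s * (d s * d s)) = h"
      by (simp add: d_def h algebra_simps)
  qed
qed

text \<open>
  The solution \<open>K\<close> of \<open>K (i - 1) j + K i (j + 1) = M i j\<close>, that is of \<open>JK + KJ = M\<close>, computed along the
  diagonals. For an \<open>n \<times> n\<close> matrix the column \<open>K i n\<close> lies outside and has to vanish.
\<close>
fun zigzag :: "(nat \<Rightarrow> nat \<Rightarrow> 'a::comm_ring_1) \<Rightarrow> nat \<Rightarrow> nat \<Rightarrow> 'a" where
  "zigzag M i 0 = 0"
| "zigzag M 0 (Suc j) = M 0 j"
| "zigzag M (Suc i) (Suc j) = M (Suc i) j - zigzag M i j"

text \<open>This turns the vanishing of column \<open>n\<close> into a condition on alternating sums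
  of \<open>M\<close>.\<close>

lemma zigzag_diagonal:
  "zigzag M i (Suc (i + e)) = (-1) ^ i * (\<Sum>s<Suc i. (-1) ^ s * M s (s + e))"
  by (induction i) (simp_all add: distrib_left right_diff_distrib)

text \<open>The recursion moves along a diagonal and reads \<open>M\<close> one column to the left,
  so the colour pattern of \<open>M\<close> is inherited with a shift by one.\<close>

lemma zigzag_eq_0:
  assumes "\<And>i j. i mod 3 \<noteq> j mod 3 \<Longrightarrow> M i j = 0" and "Suc i mod 3 \<noteq> j mod 3"
  shows "zigzag M i j = 0"
  using assms
proof (induction M i j rule: zigzag.induct)
  case (2 M j)
  from 2(2) have "0 mod 3 \<noteq> j mod 3"
    by presburger
  then show ?case
    using 2(1)[of 0 j] by simp
next
  case (3 M i j)
  from 3(3) have "Suc i mod 3 \<noteq> j mod 3"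
    by (auto simp only: mod_Suc)
  then show ?case
    using 3(1) 3(2)[of "Suc i" j] 3(2) by simp
qed simp

text \<open>\<open>J\<close>, \<open>K\<close>, \<open>D\<close> shift colours by 1, -1, 0. Of the
  nine products in the square only JK, KJ and DD have total shift 0 modulo 3; with three colours the
  shifts 2 and -2 of JJ and KK are nonzero.\<close>

lemma square_on_residues:
  fixes N :: "nat \<Rightarrow> nat \<Rightarrow> 'a::comm_ring_1"
  assumes n: "n \<ge> 4" and sq: "\<And>x :: 'a. \<exists>y z. x = y * y + 2 * z"
  shows "\<exists>Z. \<forall>i<n. \<forall>j<n. i mod 3 = j mod 3 \<longrightarrow> (\<Sum>k<n. Z i k * Z k j) = N i j"
proof -
  define N' where "N' i j = (if i mod 3 = j mod 3 then N i j else 0)" for i j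
  define y where "y e = (\<Sum>s<n - e. (-1) ^ s * N' s (s + e))" for e
  obtain d where d0: "\<And>j. 0 < j \<Longrightarrow> j < n \<Longrightarrow> 3 dvd j \<Longrightarrow> d 0 + d j = 1"
    and d: "(\<Sum>s<n. (-1) ^ s * (d s * d s)) = y 0"
    using alternating_sum_squares[OF n sq] by blast
  \<comment> \<open>\<open>Q\<close> is the square of \<open>D\<close>. On the upper diagonal number
    \<open>e > 0\<close> with \<open>3 dvd e\<close> its only nonzero entry can be
    \<open>y e\<close> in row 0, which is exactly the alternating sum to be removed from
    \<open>N'\<close>.\<close>
  define D where "D i j = (if i = j then d i else if i = 0 \<and> 3 dvd j then y j else 0)" for i j
  define Q where "Q i j = (if i = j then d i * d i else if i = 0 \<and> 3 dvd j then y j else 0)" for i j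
  define M where "M i j = N' i j - Q i j" for i j
  have D_square: "(\<Sum>k<n. D i k * D k j) = Q i j" if ij: "i < n" "j < n" for i j
  proof (cases "i = 0 \<and> 0 < j \<and> 3 dvd j")
    case True
    have "(\<Sum>k<n. D i k * D k j) = (\<Sum>k\<in>{0, j}. D i k * D k j)"
      using ij True by (intro sum.mono_neutral_right) (auto simp: D_def)
    also have "\<dots> = (d 0 + d j) * y j"
      using True by (simp add: D_def algebra_simps)
    finally show ?thesis
      using True d0[of j] ij by (simp add: Q_def)
  next
    case False
    have "(\<Sum>k<n. D i k * D k j) = (\<Sum>k\<in>{i}. D i k * D k j)"
      using ij False by (intro sum.mono_neutral_right) (auto simp: D_def)
    then show ?thesis
      using False by (auto simp: D_def Q_def)
  qed
  have M_eq_0: "M i j = 0" if "i mod 3 \<noteq> j mod 3" for i j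
    using that by (auto simp: M_def N'_def Q_def)
  have M_alternating: "(\<Sum>s<n - e. (-1) ^ s * M s (s + e)) = 0" if e: "e < n" "3 dvd e" for e
  proof -
    have "(\<Sum>s<n - e. (-1) ^ s * Q s (s + e)) = y e"
    proof (cases "e = 0")
      case True
      then show ?thesis using d by (simp add: Q_def)
    next
      case False
      have "(\<Sum>s<n - e. (-1) ^ s * Q s (s + e)) = (\<Sum>s\<in>{0}. (-1) ^ s * Q s (s + e))"
        using e False by (intro sum.mono_neutral_right) (auto simp: Q_def)
      then show ?thesis
        using e False by (simp add: Q_def)
    qed
    then show ?thesis
      by (simp add: M_def y_def right_diff_distrib sum_subtractf)
  qed
  define K where "K = zigzag M"
  have K_eq_0: "K i j = 0" if "Suc i mod 3 \<noteq> j mod 3" for i j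
    unfolding K_def using M_eq_0 that by (rule zigzag_eq_0)
  have K_last: "K i n = 0" if "i < n" "i mod 3 = (n - 1) mod 3" for i
  proof -
    \<comment> \<open>The diagonal of \<open>M\<close> through position (i, n - 1) is number
      \<open>e\<close>; up to sign, \<open>K i n\<close> is its complete alternating sum.\<close>
    define e where "e = n - 1 - i"
    have e: "n = Suc (i + e)" "e < n" "Suc i = n - e"
      using that by (auto simp: e_def)
    have "i mod 3 = (i + e) mod 3"
      using that(2) e(1) by simp
    then have "3 dvd e"
      by presburger
    then have "(\<Sum>s<Suc i. (-1) ^ s * M s (s + e)) = 0"
      unfolding e(3) by (rule M_alternating[OF e(2)])
    then show ?thesis
      unfolding K_def e(1) zigzag_diagonal by simp
  qed
  define J where "J i k = (of_bool (i = Suc k) :: 'a)" for i k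
  have J_eq_0: "J i k = 0" if "i mod 3 \<noteq> Suc k mod 3" for i k
    using that by (auto simp: J_def)
  have D_eq_0: "D i k = 0" if "i mod 3 \<noteq> k mod 3" for i k
    using that by (auto simp: D_def)
  define Z where "Z i k = J i k + K i k + D i k" for i k
  have "(\<Sum>k<n. Z i k * Z k j) = N i j" if ij: "i < n" "j < n" "i mod 3 = j mod 3" for i j
  proof -
    have "Z i k * Z k j = J i k * K k j + K i k * J k j + D i k * D k j" for k
    proof -
      have "i mod 3 < 3" "k mod 3 < 3"
        by simp_all
      then have "k mod 3 = i mod 3 \<or> k mod 3 = Suc i mod 3 \<or> i mod 3 = Suc k mod 3"
        unfolding mod_Suc by presburger
      then consider "k mod 3 = i mod 3" | "k mod 3 = Suc i mod 3" | "i mod 3 = Suc k mod 3"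
        by blast
      then show ?thesis
      proof cases
        case 1
        then have "i mod 3 \<noteq> Suc k mod 3" "k mod 3 \<noteq> Suc j mod 3"
          "Suc i mod 3 \<noteq> k mod 3" "Suc k mod 3 \<noteq> j mod 3"
          using ij(3) unfolding mod_Suc by (auto split: if_splits)
        then show ?thesis
          by (simp add: Z_def J_eq_0 K_eq_0)
      next
        case 2
        then have "i mod 3 \<noteq> Suc k mod 3" "i mod 3 \<noteq> k mod 3"
          "k mod 3 \<noteq> j mod 3" "Suc k mod 3 \<noteq> j mod 3"
          using ij(3) unfolding mod_Suc by (auto split: if_splits)
        then show ?thesis
          by (simp add: Z_def J_eq_0 K_eq_0 D_eq_0)
      next
        case 3
        then have "Suc i mod 3 \<noteq> k mod 3" "i mod 3 \<noteq> k mod 3"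
          "k mod 3 \<noteq> j mod 3" "k mod 3 \<noteq> Suc j mod 3"
          using ij(3) unfolding mod_Suc by (auto split: if_splits)
        then show ?thesis
          by (simp add: Z_def J_eq_0 K_eq_0 D_eq_0)
      qed
    qed
    then have "(\<Sum>k<n. Z i k * Z k j) =
        (\<Sum>k<n. J i k * K k j) + (\<Sum>k<n. K i k * J k j) + Q i j"
      using ij by (simp add: sum.distrib D_square)
    also have "(\<Sum>k<n. J i k * K k j) = (if i = 0 then 0 else K (i - 1) j)"
    proof (cases i)
      case (Suc l)
      have "(\<Sum>k<n. J i k * K k j) = (\<Sum>k\<in>{l}. J i k * K k j)"
        using ij Suc by (intro sum.mono_neutral_right) (auto simp: J_def)
      then show ?thesis
        using Suc by (simp add: J_def)
    qed (simp add: J_def)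
    also have "(\<Sum>k<n. K i k * J k j) = K i (Suc j)"
    proof (cases "Suc j = n")
      case True
      then have "(\<Sum>k<n. K i k * J k j) = 0"
        by (intro sum.neutral) (auto simp: J_def)
      then show ?thesis
        using K_last[of i] ij True by auto
    next
      case False
      have "(\<Sum>k<n. K i k * J k j) = (\<Sum>k\<in>{Suc j}. K i k * J k j)"
        using ij False by (intro sum.mono_neutral_right) (auto simp: J_def)
      then show ?thesis
        by (simp add: J_def)
    qed
    also have "(if i = 0 then 0 else K (i - 1) j) + K i (Suc j) = M i j"
      by (cases i) (simp_all add: K_def)
    finally show ?thesis
      using ij by (simp add: M_def N'_def)
  qed
  then show ?thesis
    by blast
qed

section \<open>Universality from three unit coefficients\<close>

text \<open>\<open>Z\<close> is chosen first, against the known \<open>\<Delta>\<close> and its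
  transpose. The remainder \<open>B\<close> then matters only between distinct colours, where
  \<open>X\<close> takes the lower and the transpose of \<open>Y\<close> the upper part without
  overlap.\<close>

lemma universal_form_3:
  fixes a :: "nat \<Rightarrow> 'a::comm_ring_1"
  assumes n: "n \<ge> 4" and sq: "\<And>x :: 'a. \<exists>y z. x = y * y + 2 * z"
    and a: "\<And>i. i < 3 \<Longrightarrow> a i dvd 1"
  shows "universal_form n 3 a"
  unfolding universal_form_def
proof
  fix A :: "'a mat"
  assume A: "A \<in> carrier_mat n n"
  obtain u where u: "\<And>i. i < 3 \<Longrightarrow> a i * u i = 1"
    using a unfolding dvd_def by metis
  have cancel: "a i * (u i * x) = x" if "i < 3" for i x
    using u[OF that] by (simp flip: mult.assoc)
  obtain \<Delta> :: "nat \<Rightarrow> nat \<Rightarrow> 'a" where \<Delta>: "\<And>W. \<exists>X. \<forall>i<n. \<forall>j<n. (\<Sum>k<n. X i k * X k j) =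
      (if i mod 3 > j mod 3 then W i j else if i mod 3 = j mod 3 then \<Delta> i j else 0)"
    using block_lower_square[OF n] by blast
  obtain Z where Z: "\<forall>i<n. \<forall>j<n. i mod 3 = j mod 3 \<longrightarrow>
      (\<Sum>k<n. Z i k * Z k j) = u 2 * (A $$ (i, j) - a 0 * \<Delta> i j - a 1 * \<Delta> j i)"
    using square_on_residues[OF n sq,
        of "\<lambda>i j. u 2 * (A $$ (i, j) - a 0 * \<Delta> i j - a 1 * \<Delta> j i)"] by blast
  define B where "B i j = A $$ (i, j) - a 2 * (\<Sum>k<n. Z i k * Z k j)" for i j
  obtain X where X: "\<forall>i<n. \<forall>j<n. (\<Sum>k<n. X i k * X k j) =
      (if i mod 3 > j mod 3 then u 0 * B i j else if i mod 3 = j mod 3 then \<Delta> i j else 0)"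
    using \<Delta>[of "\<lambda>i j. u 0 * B i j"] by blast
  obtain Y where Y: "\<forall>i<n. \<forall>j<n. (\<Sum>k<n. Y i k * Y k j) =
      (if i mod 3 > j mod 3 then u 1 * B j i else if i mod 3 = j mod 3 then \<Delta> i j else 0)"
    using \<Delta>[of "\<lambda>i j. u 1 * B j i"] by blast
  have sum_eq: "a 0 * (\<Sum>k<n. X i k * X k j) + (a 1 * (\<Sum>k<n. Y k i * Y j k) +
      a 2 * (\<Sum>k<n. Z i k * Z k j)) = A $$ (i, j)" if ij: "i < n" "j < n" for i j
  proof -
    have "(\<Sum>k<n. Y k i * Y j k) = (\<Sum>k<n. Y j k * Y k i)"
      by (simp add: mult.commute)
    then have Y': "(\<Sum>k<n. Y k i * Y j k) =
      (if j mod 3 > i mod 3 then u 1 * B i j else if j mod 3 = i mod 3 then \<Delta> j i else 0)"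
      using Y ij by simp
    consider "i mod 3 < j mod 3" | "i mod 3 = j mod 3" | "i mod 3 > j mod 3"
      by linarith
    then show ?thesis
    proof cases
      case 1
      then show ?thesis
        using X Y' ij by (simp add: cancel B_def)
    next
      case 2
      then show ?thesis
        using X Y' Z ij by (simp add: cancel)
    next
      case 3
      then show ?thesis
        using X Y' ij by (simp add: cancel B_def)
    qed
  qed
  define F where "F l = mat n n (\<lambda>(i, j). if l = 0 then X i j else if l = 1 then Y j i else Z i j)"
    for l :: nat
  have F: "F l \<in> carrier_mat n n" for l
    by (simp add: F_def)
  then have F_pow: "F l ^\<^sub>m 2 \<in> carrier_mat n n" for l
    by simp
  interpret ring "ring_mat TYPE('a) n ()"
    by (rule ring_mat)
  have "{..<3} = {0, 1, 2 :: nat}"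
    by auto
  then have "(\<Oplus>\<^bsub>ring_mat TYPE('a) n ()\<^esub> i \<in> {..<3}. a i \<cdot>\<^sub>m (F i ^\<^sub>m 2)) =
      a 0 \<cdot>\<^sub>m (F 0 ^\<^sub>m 2) + (a 1 \<cdot>\<^sub>m (F 1 ^\<^sub>m 2) + a 2 \<cdot>\<^sub>m (F 2 ^\<^sub>m 2))"
    using F_pow by (simp add: ring_mat_simps)
  also have "\<dots> = A"
  proof (rule eq_matI)
    fix i j assume ij: "i < dim_row A" "j < dim_col A"
    have F_square: "(F l ^\<^sub>m 2) $$ (i, j) = (\<Sum>k<n. F l $$ (i, k) * F l $$ (k, j))" for l
      using ij A F[of l] by (simp add: numeral_2_eq_2 scalar_prod_def atLeast0LessThan)
    have "(F 0 ^\<^sub>m 2) $$ (i, j) = (\<Sum>k<n. X i k * X k j)"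
      "(F 1 ^\<^sub>m 2) $$ (i, j) = (\<Sum>k<n. Y k i * Y j k)"
      "(F 2 ^\<^sub>m 2) $$ (i, j) = (\<Sum>k<n. Z i k * Z k j)"
      unfolding F_square using ij A by (simp_all add: F_def)
    then show "(a 0 \<cdot>\<^sub>m (F 0 ^\<^sub>m 2) + (a 1 \<cdot>\<^sub>m (F 1 ^\<^sub>m 2) + a 2 \<cdot>\<^sub>m (F 2 ^\<^sub>m 2))) $$ (i, j) =
        A $$ (i, j)"
      using ij A carrier_matD[OF F_pow] sum_eq[of i j] by simp
  qed (use A F in auto)
  finally show "\<exists>X. (\<forall>i<3. X i \<in> carrier_mat n n) \<and>
      A = (\<Oplus>\<^bsub>ring_mat TYPE('a) n ()\<^esub> i \<in> {..<3}. a i \<cdot>\<^sub>m (X i ^\<^sub>m 2))"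
    using F by (intro exI[of _ F]) simp
qed

section \<open>Squares modulo 2 in the p-adic integers\<close>

lemma padic_residue_Suc_mod_prime:
  "padic_residue (x :: 'p::prime_card padic_int) (Suc k) mod int CARD('p) = padic_residue x 1"
proof (induction k)
  case 0
  show ?case
    using padic_residue_mod[of x 1] by simp
next
  case (Suc k)
  have "padic_residue x (Suc (Suc k)) mod int CARD('p) ^ Suc k mod int CARD('p) =
      padic_residue x (Suc (Suc k)) mod int CARD('p)"
    by (rule mod_mod_cancel) simp
  then show ?case
    using Suc by (simp only: padic_residue_Suc_mod)
qed

lemma padic_int_of_residues:
  assumes "\<And>k. f (Suc k) mod int CARD('p) ^ k = f k"
  obtains z :: "'p::prime_card padic_int" where "padic_residue z = f"
  using assms by (intro that[of "Abs_padic_int f"] Abs_padic_int_inverse) simp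

lemma padic_double_of_residue:
  fixes x :: "'p::prime_card padic_int"
  assumes "CARD('p) = 2" and "padic_residue x 1 = 0"
  shows "\<exists>z. x = 2 * z"
proof -
  \<comment> \<open>Halving loses one binary digit, hence the residue at
    \<open>Suc k\<close>.\<close>
  define f where "f k = padic_residue x (Suc k) div 2" for k
  have "f (Suc k) mod int CARD('p) ^ k = f k" for k
  proof -
    have "f (Suc k) mod 2 ^ k = padic_residue x (Suc (Suc k)) mod (2 * 2 ^ k) div 2"
      unfolding f_def by (simp add: zmod_zmult2_eq)
    then show ?thesis
      using padic_residue_Suc_mod[of x "Suc k"] assms(1) by (simp add: f_def)
  qed
  then obtain z :: "'p padic_int" where z: "padic_residue z = f"
    by (rule padic_int_of_residues)
  have "padic_residue (z + z) k = padic_residue x k" for k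
  proof -
    have "f k + f k = padic_residue x (Suc k)"
      using padic_residue_Suc_mod_prime[of x k] assms unfolding f_def by simp presburger
    then show ?thesis
      unfolding plus_padic_int.rep_eq z by simp
  qed
  then have "x = z + z"
    by (metis ext padic_residue_inject)
  then show ?thesis
    by (metis mult_2)
qed

lemma padic_half:
  fixes x :: "'p::prime_card padic_int"
  assumes "odd CARD('p)"
  shows "\<exists>z. x = 2 * z"
proof -
  \<comment> \<open>(q^k + 1) / 2 is the inverse of 2 modulo q^k.\<close>
  let ?q = "int CARD('p)"
  define f where "f k = (padic_residue x k * ((?q ^ k + 1) div 2)) mod ?q ^ k" for k
  have f2: "[2 * f k = padic_residue x k] (mod ?q ^ k)" for k
  proof -
    have "2 * ((?q ^ k + 1) div 2) = ?q ^ k + 1"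
      using assms by (intro dvd_mult_div_cancel) simp
    then have "2 * (padic_residue x k * ((?q ^ k + 1) div 2)) =
        padic_residue x k + padic_residue x k * ?q ^ k"
      by (metis distrib_left mult.left_commute mult.right_neutral add.commute)
    then show ?thesis
      unfolding f_def cong_def by (simp add: mod_mult_right_eq)
  qed
  have "f (Suc k) mod ?q ^ k = f k" for k
  proof -
    have "[2 * f (Suc k) = padic_residue x (Suc k)] (mod ?q ^ k)"
      using f2[of "Suc k"] by (rule cong_dvd_modulus) simp
    also have "[padic_residue x (Suc k) = padic_residue x k] (mod ?q ^ k)"
      by (simp add: cong_def)
    also have "[padic_residue x k = 2 * f k] (mod ?q ^ k)"
      using f2[of k] by (rule cong_sym)
    finally have "[f (Suc k) = f k] (mod ?q ^ k)"
      using assms by (subst (asm) cong_mult_lcancel) auto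
    then show ?thesis
      by (simp add: cong_def f_def)
  qed
  then obtain z :: "'p padic_int" where z: "padic_residue z = f"
    by (rule padic_int_of_residues)
  have "padic_residue (z + z) k = padic_residue x k" for k
    using f2[of k] unfolding plus_padic_int.rep_eq z cong_def by simp
  then have "x = z + z"
    by (metis ext padic_residue_inject)
  then show ?thesis
    by (metis mult_2)
qed

text \<open>For odd p, 2 divides everything. For p = 2 the residue field has only 0 and 1, which are
  their own squares.\<close>

lemma padic_square_mod_2: "\<exists>y z. (x :: 'p::prime_card padic_int) = y * y + 2 * z"
proof (cases "odd CARD('p)")
  case True
  then obtain z where "x = 2 * z"
    using padic_half by blast
  then have "x = 0 * 0 + 2 * z"
    by simp
  then show ?thesis
    by blast
next
  case False
  then have p: "CARD('p) = 2"
    using prime_card primes_dvd_imp_eq two_is_prime_nat by metis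
  show ?thesis
  proof (cases "padic_residue x 1 = 0")
    case True
    then obtain z where "x = 0 * 0 + 2 * z"
      using padic_double_of_residue[OF p] by auto
    then show ?thesis
      by blast
  next
    case False
    then have "padic_residue (x - 1) 1 = 0"
      using padic_residue_mod[of x 1] p
      by (simp add: minus_padic_int.rep_eq one_padic_int.rep_eq)
    then obtain z where "x - 1 = 2 * z"
      using padic_double_of_residue[OF p] by blast
    then have "x = 1 * 1 + 2 * z"
      by (simp add: algebra_simps)
    then show ?thesis
      by blast
  qed
qed

theorem theorem3p2:
  fixes n :: nat
  assumes "n \<ge> 4"
  shows "(odd CARD('p::prime_card) \<longrightarrow> min_universal TYPE('p) n \<le> 3) \<and>
         (CARD('p) = 2 \<longrightarrow> min_universal TYPE('p) n \<le> 4)"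
proof -
  \<comment> \<open>Both bounds come from \<open>m = 3\<close>, where three unit indices are all the
    indices.\<close>
  have "universal_form n 3 a" if "card {i. i < 3 \<and> a i dvd 1} \<ge> 3" for a :: "nat \<Rightarrow> 'p padic_int"
  proof -
    have "{i. i < 3 \<and> a i dvd 1} = {..<3}"
      using that by (intro card_seteq) auto
    then have "a i dvd 1" if "i < 3" for i
      using that by blast
    then show ?thesis
      by (rule universal_form_3[OF assms padic_square_mod_2])
  qed
  then have "min_universal TYPE('p) n \<le> enat 3"
    unfolding min_universal_def by (intro Inf_lower imageI) simp
  then have le_3: "min_universal TYPE('p) n \<le> 3"
    by (simp add: numeral_eq_enat)
  have "(3 :: enat) \<le> 4"
    by simp
  with le_3 have "min_universal TYPE('p) n \<le> 4"
    by (rule order_trans)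
  with le_3 show ?thesis
    by blast
qed

end
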